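(* Let $\theta$ be the model parameters, and let $\alpha$ be the fraction of perturbed training data. Denote by $L_c(\theta)$ and $L_u(\theta)$ the average loss on the clean data $\mathcal{D}_c$ and on the perturbed data $\mathcal{D}_u$, respectively. For a learning rate $\eta$, the change in the clean data loss after one gradient descent step $\theta_{t+1} = \theta_t - \eta\,\nabla_\theta L(\theta_t)$ on the total training loss $L(\theta) = \alpha L_u(\theta) + (1-\alpha)L_c(\theta)$ is given by $$L_c(\theta_{t+1}) - L_c(\theta_t) = -\eta\, \nabla_\theta L_c(\theta_t)\cdot\left[\alpha \nabla_\theta L_u(\theta_t) + (1-\alpha)\nabla_\theta L_c(\theta_t)\right].$$ Under the gradient orthogonality assumption (for all $\theta$ encountered during training, the average loss gradient over the clean subset is orthogonal to the average loss gradient over the perturbed subset), i.e. $\nabla_\theta L_c(\theta_t)\cdot \nabla_\theta L_u(\theta_t) = 0$, the update simplifies to $$L_c(\theta_{t+1}) - L_c(\theta_t) = -\eta(1-\alpha)\,\|\nabla_\theta L_c(\theta_t)\|^2.$$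
   Context: A training set consists of $n$ labelled samples $(x_i,y_i)$ with $x_i\in\mathbb{R}^d$ and $y_i\in\{1,\dots,K\}$. A fraction $\alpha$ ($0<\alpha<1$) of the samples is perturbed by adding vectors $\delta_i\in\mathbb{R}^d$ to the inputs; $\mathcal{D}_u$ denotes the set of perturbed samples and $\mathcal{D}_c$ the set of the remaining $(1-\alpha)n$ clean samples. For a model $f_\theta$ with parameters $\theta$ and a loss function $\ell$, $$L_c(\theta) = \frac{1}{(1-\alpha)n}\sum_{(x_i,y_i)\in\mathcal{D}_c}\ell(f_\theta(x_i),y_i),\qquad L_u(\theta) = \frac{1}{\alpha n}\sum_{(x_i,y_i)\in\mathcal{D}_u}\ell(f_\theta(x_i+\delta_i),y_i).$$ Here $\theta_t$ is the parameter vector at step $t$, $\nabla_\theta$ is the gradient in $\theta$, $\cdot$ is the Euclidean inner product and $\|\cdot\|$ the Euclidean norm on the parameter space.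
   Formalization: Both displayed equalities for the change in clean loss are proved to first order in the learning rate, i.e. up to an error o(η) as η → 0+, for losses differentiable at θ_t; exact equality fails, e.g. for both losses equal to θ². *)

theory Defs
  imports "HOL-Analysis.Analysis" "HOL-Library.Landau_Symbols"
begin

text \<open>The gradient vector is unique when it exists; \<open>grad F \<theta>\<close> is unspecified when \<open>F\<close> is not
  differentiable at \<open>\<theta>\<close>.\<close>

definition grad :: "('p::euclidean_space \<Rightarrow> real) \<Rightarrow> 'p \<Rightarrow> 'p" where
  "grad F \<theta> = (THE D. GDERIV F \<theta> :> D)"

text \<open>Samples are indexed by \<open>i < n\<close>; \<open>U\<close> is the set of indices of the perturbed samples, and its
  complement in \<open>{..<n}\<close> indexes the clean ones. \<open>f \<theta> x\<close> is the output of the model with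
  parameters \<open>\<theta>\<close> on input \<open>x\<close>, and \<open>l\<close> compares an output with a label.\<close>

definition clean_loss ::
  "real \<Rightarrow> nat \<Rightarrow> nat set \<Rightarrow> (nat \<Rightarrow> real ^ 'd) \<Rightarrow> (nat \<Rightarrow> nat)
    \<Rightarrow> ('p \<Rightarrow> real ^ 'd \<Rightarrow> 'o) \<Rightarrow> ('o \<Rightarrow> nat \<Rightarrow> real) \<Rightarrow> 'p \<Rightarrow> real" where
  "clean_loss \<alpha> n U x y f l \<theta> =
     1 / ((1 - \<alpha>) * real n) * (\<Sum>i\<in>{..<n} - U. l (f \<theta> (x i)) (y i))"

definition perturbed_loss ::
  "real \<Rightarrow> nat \<Rightarrow> nat set \<Rightarrow> (nat \<Rightarrow> real ^ 'd) \<Rightarrow> (nat \<Rightarrow> real ^ 'd) \<Rightarrow> (nat \<Rightarrow> nat)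
    \<Rightarrow> ('p \<Rightarrow> real ^ 'd \<Rightarrow> 'o) \<Rightarrow> ('o \<Rightarrow> nat \<Rightarrow> real) \<Rightarrow> 'p \<Rightarrow> real" where
  "perturbed_loss \<alpha> n U x \<delta> y f l \<theta> =
     1 / (\<alpha> * real n) * (\<Sum>i\<in>U. l (f \<theta> (x i + \<delta> i)) (y i))"

definition total_loss :: "real \<Rightarrow> ('p \<Rightarrow> real) \<Rightarrow> ('p \<Rightarrow> real) \<Rightarrow> 'p \<Rightarrow> real" where
  "total_loss \<alpha> Lu Lc \<theta> = \<alpha> * Lu \<theta> + (1 - \<alpha>) * Lc \<theta>"

definition gd_step :: "('p::euclidean_space \<Rightarrow> real) \<Rightarrow> real \<Rightarrow> 'p \<Rightarrow> 'p" where
  "gd_step F \<eta> \<theta> = \<theta> - \<eta> *\<^sub>R grad F \<theta>"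

text \<open>Equality to first order in the learning rate: an exact equality of the loss change with its
  linear Taylor term fails for losses with curvature, e.g. \<open>\<theta>\<^sup>2\<close>.\<close>

definition first_order_eq :: "(real \<Rightarrow> real) \<Rightarrow> (real \<Rightarrow> real) \<Rightarrow> bool" where
  "first_order_eq g h \<longleftrightarrow> (\<lambda>\<eta>. g \<eta> - h \<eta>) \<in> o[at_right 0](\<lambda>\<eta>. \<eta>)"

end

theory Submission imports Defs begin

text \<open>The gradient step moves along the straight ray
  \<open>\<theta> - \<eta> *\<^sub>R v\<close>, whose direction v does not depend on the learning
  rate. By the chain rule, a function with gradient D at \<theta> has derivative
  \<open>- (D \<bullet> v)\<close> along this ray at \<eta> = 0, so its increment is
  \<open>- \<eta> * (D \<bullet> v)\<close> up to o(\<eta>); this is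
  \<open>first_order_eq_gderiv\<close>. It is applied to the clean loss, with v the gradient of the
  total loss, which \<open>grad_total_loss\<close> splits by linearity into the weighted sum of the
  two gradients. Orthogonality then removes the cross term.\<close>

lemma gderiv_unique:
  fixes F :: "'p::euclidean_space \<Rightarrow> real"
  assumes "GDERIV F \<theta> :> D" and "GDERIV F \<theta> :> D'"
  shows "D = D'"
proof -
  have "(\<lambda>h. h \<bullet> D) = (\<lambda>h. h \<bullet> D')"
    using assms unfolding gderiv_def by (rule has_derivative_unique)
  then show ?thesis
    by (simp add: fun_eq_iff vector_eq_ldot)
qed

lemma grad_eqI:
  fixes F :: "'p::euclidean_space \<Rightarrow> real"
  assumes "GDERIV F \<theta> :> D"
  shows "grad F \<theta> = D"
  unfolding grad_def using assms by (blast intro: gderiv_unique)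

text \<open>The Riesz representative of the derivative F' is \<open>adjoint F' 1\<close>: the inner
  product on the reals is multiplication, so moving F' across it in \<open>F' h * 1\<close> gives
  the required form. Uniqueness of the gradient identifies this vector with the \<open>THE\<close>
  in \<open>grad\<close>.\<close>

lemma gderiv_grad:
  fixes F :: "'p::euclidean_space \<Rightarrow> real"
  assumes "F differentiable at \<theta>"
  shows "GDERIV F \<theta> :> grad F \<theta>"
proof -
  obtain F' where F': "(F has_derivative F') (at \<theta>)"
    using assms by (auto simp: differentiable_def)
  then have lin: "linear F'"
    by (rule has_derivative_linear)
  have "F' = (\<lambda>h. h \<bullet> adjoint F' 1)"
    using adjoint_works[OF lin] by (simp add: fun_eq_iff)
  then have "GDERIV F \<theta> :> adjoint F' 1"
    using F' by (simp add: gderiv_def)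
  then show ?thesis
    by (simp add: grad_eqI)
qed

lemma grad_total_loss:
  fixes Lu Lc :: "'p::euclidean_space \<Rightarrow> real"
  assumes "Lu differentiable at \<theta>" and "Lc differentiable at \<theta>"
  shows "grad (total_loss \<alpha> Lu Lc) \<theta> = \<alpha> *\<^sub>R grad Lu \<theta> + (1 - \<alpha>) *\<^sub>R grad Lc \<theta>"
proof (rule grad_eqI)
  show "GDERIV (total_loss \<alpha> Lu Lc) \<theta> :> \<alpha> *\<^sub>R grad Lu \<theta> + (1 - \<alpha>) *\<^sub>R grad Lc \<theta>"
    using gderiv_grad[OF assms(1)] gderiv_grad[OF assms(2)]
    unfolding gderiv_def total_loss_def[abs_def]
    by (auto intro!: derivative_eq_intros simp: inner_add_right)
qed

lemma first_order_eq_gderiv: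
  fixes F :: "'p::euclidean_space \<Rightarrow> real"
  assumes "GDERIV F \<theta> :> D"
  shows "first_order_eq (\<lambda>\<eta>. F (\<theta> - \<eta> *\<^sub>R v) - F \<theta>) (\<lambda>\<eta>. - \<eta> * (D \<bullet> v))"
proof -
  \<comment> \<open>The base point is written as the ray at \<eta> = 0, the form in which the chain
    rule asks for it.\<close>
  have F: "(F has_derivative (\<lambda>h. h \<bullet> D)) (at (\<theta> - 0 *\<^sub>R v))"
    using assms by (simp add: gderiv_def)
  have "((\<lambda>\<eta>. \<theta> - \<eta> *\<^sub>R v) has_derivative (\<lambda>h. - (h *\<^sub>R v))) (at (0::real))"
    by (auto intro!: derivative_eq_intros)
  from has_derivative_compose[OF this, of F "\<lambda>h. h \<bullet> D"] F
  have "((\<lambda>\<eta>. F (\<theta> - \<eta> *\<^sub>R v)) has_derivative (\<lambda>h. - (h *\<^sub>R v) \<bullet> D)) (at 0)"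
    by blast
  moreover have "(\<lambda>h. - (h *\<^sub>R v) \<bullet> D) = (*) (- (D \<bullet> v))"
    by (simp add: fun_eq_iff inner_commute)
  ultimately have "((\<lambda>\<eta>. F (\<theta> - \<eta> *\<^sub>R v)) has_real_derivative - (D \<bullet> v)) (at 0)"
    by (simp add: has_field_derivative_def)
  then have "((\<lambda>\<eta>. (F (\<theta> - \<eta> *\<^sub>R v) - F \<theta>) / \<eta>) \<longlongrightarrow> - (D \<bullet> v)) (at 0)"
    by (simp add: DERIV_def)
  \<comment> \<open>The derivative is a two-sided limit; learning rates are positive, so only its
    right half is kept.\<close>
  then have lim: "((\<lambda>\<eta>. (F (\<theta> - \<eta> *\<^sub>R v) - F \<theta>) / \<eta> - - (D \<bullet> v)) \<longlongrightarrow> 0) (at_right 0)"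
    by (intro LIM_zero) (simp add: filterlim_at_split)
  have nz: "\<forall>\<^sub>F \<eta> in at_right (0::real). \<eta> \<noteq> 0"
    by (simp add: eventually_at_filter)
  \<comment> \<open>Putting the linear term over the common denominator \<eta> turns the limit into
    the quotient criterion for little-o.\<close>
  have "((\<lambda>\<eta>. (F (\<theta> - \<eta> *\<^sub>R v) - F \<theta> - - \<eta> * (D \<bullet> v)) / \<eta>) \<longlongrightarrow> 0) (at_right 0)"
  proof (rule Lim_transform_eventually[OF lim])
    show "\<forall>\<^sub>F \<eta> in at_right 0. (F (\<theta> - \<eta> *\<^sub>R v) - F \<theta>) / \<eta> - - (D \<bullet> v) =
        (F (\<theta> - \<eta> *\<^sub>R v) - F \<theta> - - \<eta> * (D \<bullet> v)) / \<eta>"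
      using nz by eventually_elim (simp add: diff_divide_distrib add_divide_distrib)
  qed
  then show ?thesis
    unfolding first_order_eq_def using nz by (intro smalloI_tendsto)
qed

theorem theorem1:
  fixes \<alpha> :: real and n K :: nat and U :: "nat set"
    and x \<delta> :: "nat \<Rightarrow> real ^ 'd" and y :: "nat \<Rightarrow> nat"
    and f :: "'p::euclidean_space \<Rightarrow> real ^ 'd \<Rightarrow> 'o" and l :: "'o \<Rightarrow> nat \<Rightarrow> real"
    and Lc Lu L :: "'p \<Rightarrow> real" and \<theta>\<^sub>t :: 'p
  assumes "0 < n" and "0 < \<alpha>" and "\<alpha> < 1"
    and "\<forall>i<n. y i \<in> {1..K}"
    and "U \<subseteq> {..<n}" and "real (card U) = \<alpha> * real n"
    and Lc: "Lc = clean_loss \<alpha> n U x y f l"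
    and Lu: "Lu = perturbed_loss \<alpha> n U x \<delta> y f l"
    and L: "L = total_loss \<alpha> Lu Lc"
    and "Lc differentiable at \<theta>\<^sub>t" and "Lu differentiable at \<theta>\<^sub>t"
  shows "first_order_eq
           (\<lambda>\<eta>. Lc (gd_step L \<eta> \<theta>\<^sub>t) - Lc \<theta>\<^sub>t)
           (\<lambda>\<eta>. - \<eta> * (grad Lc \<theta>\<^sub>t \<bullet> (\<alpha> *\<^sub>R grad Lu \<theta>\<^sub>t + (1 - \<alpha>) *\<^sub>R grad Lc \<theta>\<^sub>t)))
       \<and> (grad Lc \<theta>\<^sub>t \<bullet> grad Lu \<theta>\<^sub>t = 0 \<longrightarrow>
          first_order_eq
            (\<lambda>\<eta>. Lc (gd_step L \<eta> \<theta>\<^sub>t) - Lc \<theta>\<^sub>t)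
            (\<lambda>\<eta>. - \<eta> * (1 - \<alpha>) * (norm (grad Lc \<theta>\<^sub>t))\<^sup>2))"
proof -
  have "first_order_eq
           (\<lambda>\<eta>. Lc (gd_step L \<eta> \<theta>\<^sub>t) - Lc \<theta>\<^sub>t)
           (\<lambda>\<eta>. - \<eta> * (grad Lc \<theta>\<^sub>t \<bullet> (\<alpha> *\<^sub>R grad Lu \<theta>\<^sub>t + (1 - \<alpha>) *\<^sub>R grad Lc \<theta>\<^sub>t)))"
    unfolding gd_step_def L
      grad_total_loss[OF \<open>Lu differentiable at \<theta>\<^sub>t\<close> \<open>Lc differentiable at \<theta>\<^sub>t\<close>]
    by (rule first_order_eq_gderiv[OF gderiv_grad[OF \<open>Lc differentiable at \<theta>\<^sub>t\<close>]])
  \<comment> \<open>When the cross term vanishes, the inner product is (1 - \<alpha>) times the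
    squared norm, so both linear terms are the same function of \<eta>.\<close>
  then show ?thesis
    by (auto simp: inner_add_right power2_norm_eq_inner mult.assoc)
qed

end
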